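(* Let $F_q$ be a finite field with $q$ elements and let $R$ be a finite noncommutative associative algebra with unity over $F_q$, having $q^n$ elements. Let $C$ be the center of $R$, let $I = \{x \in R \mid x^q - x \in C\}$, and let $r = \frac{|I|}{|R|}$. Then $r \leq \frac{q^2 - q + 1}{q^2}$. Further, if $r = \frac{q^2 - q + 1}{q^2}$, then $R$ is generated as an algebra by the center $C$ and two non-commuting elements $b, c \in I$ such that $C \subseteq I$, $|C| = q^{n-2}$ and $|C_b| = |C_c| = q^{n-1}$.
   Context: For an element $b$ of a ring $R$, $C_b$ denotes the set of all elements of $R$ which commute with $b$. All rings and algebras are associative with unity. *)

theory Defs
  imports Complex_Main "HOL-Library.Cardinality"
begin

text \<open>
  The algebra is carried by a whole type of class \<open>ring_1\<close>; its scalar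
  multiplication is the locale parameter. (The locale \<open>algebra\<close> of HOL-Algebra
  is restricted to commutative algebras.)
\<close>

locale unital_algebra = vector_space scale
  for scale :: "'k::field \<Rightarrow> 'a::ring_1 \<Rightarrow> 'a" (infixr "*s" 75) +
  assumes scale_mult_left: "(a *s x) * y = a *s (x * y)"
    and scale_mult_right: "x * (a *s y) = a *s (x * y)"
begin

definition subalgebra :: "'a set \<Rightarrow> bool" where
  "subalgebra S \<longleftrightarrow> subspace S \<and> 1 \<in> S \<and> (\<forall>x\<in>S. \<forall>y\<in>S. x * y \<in> S)"

definition generated_subalgebra :: "'a set \<Rightarrow> 'a set" where
  "generated_subalgebra X = subalgebra hull X"

end

definition centralizer :: "'a::ring_1 \<Rightarrow> 'a set" where
  "centralizer b = {x. x * b = b * x}"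

definition ring_center :: "'a::ring_1 set" where
  "ring_center = {z. \<forall>x. z * x = x * z}"

definition central_power_diff :: "nat \<Rightarrow> 'a::ring_1 set" where
  "central_power_diff q = {x. x ^ q - x \<in> ring_center}"

end

theory Submission
  imports Defs "HOL-Computational_Algebra.Polynomial"
begin

text \<open>
  Write \<open>C\<^sub>x\<close> for the centralizer of \<open>x\<close> and \<open>[x, y] = x y - y x\<close>. Membership \<open>x \<in> I\<close> means exactly that
  \<open>[x\<^sup>q, z] = [x, z]\<close> for all \<open>z\<close>.

  The heart of the proof is that a line \<open>{y + t x | t \<in> F\<^sub>q}\<close> with direction \<open>x \<in> I\<close> lies in \<open>I\<close> only if
  \<open>x\<close> and \<open>y\<close> commute (\<open>commute_of_line_subset_central_power_diff\<close>). Expand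
  \<open>(y + t x)\<^sup>q\<close> in powers of \<open>t\<close> and take commutators with a fixed \<open>z\<close>. Since \<open>t\<^sup>q = t\<close>, this is a
  polynomial in \<open>t\<close> of degree less than \<open>q\<close> that vanishes on all of \<open>F\<^sub>q\<close>, so its coefficients are zero;
  hence the coefficient \<open>L\<close> of \<open>t\<close> in the expansion is central. But
  \<open>L = \<Sum> y\<^sup>j x y\<^sup>q\<^sup>-\<^sup>1\<^sup>-\<^sup>j\<close>, so \<open>[y, L]\<close> telescopes to \<open>[y\<^sup>q, x] = [y, x]\<close>.

  Now fix a noncentral \<open>x \<in> I\<close>. Every line in direction \<open>x\<close> outside \<open>C\<^sub>x\<close> misses \<open>I\<close> at some point, so
  \<open>I\<close> omits at least \<open>1/q\<close> of the complement of \<open>C\<^sub>x\<close>, and \<open>C\<^sub>x\<close> itself fills at most \<open>1/q\<close> of \<open>R\<close>.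
  This gives density at most \<open>1 - 1/q + 1/q\<^sup>2\<close>, and equality forces \<open>C\<^sub>x\<close> to be a hyperplane contained
  in \<open>I\<close> (\<open>card_central_power_diff_noncentral\<close>).

  If equality holds, choose noncommuting \<open>b, c \<in> I\<close> and let \<open>D = C\<^sub>b \<inter> C\<^sub>c\<close>. As \<open>C\<^sub>b\<close> and \<open>C\<^sub>c\<close> are
  distinct hyperplanes, \<open>R = D \<oplus> F\<^sub>q b \<oplus> F\<^sub>q c\<close>, and all that remains is that \<open>D\<close> is commutative,
  for then \<open>D\<close> is the center (\<open>extremal_structure\<close>). For \<open>d, e \<in> D\<close> the element \<open>d + b\<close> is again a
  noncentral element of \<open>I\<close>, so its commutators span one dimension and \<open>[d, e] = [d + b, e]\<close> is a
  multiple of \<open>[d + b, c] = [b, c]\<close>. Therefore \<open>d\<close> commutes with \<open>[d, e]\<close>, so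
  \<open>[d, e] = [d\<^sup>q, e] = q d\<^sup>q\<^sup>-\<^sup>1 [d, e] = 0\<close>.
\<close>

section \<open>Finite fields\<close>

text \<open>
  Multiplication by \<open>t \<noteq> 0\<close> permutes the nonzero elements, so it does not change their product.
\<close>

lemma finite_field_power_card:
  fixes t :: "'k::{field,finite}"
  shows "t ^ CARD('k) = t"
proof (cases "t = 0")
  case False
  have "bij_betw ((*) t) (UNIV - {0}) (UNIV - {0})"
    using False by (intro bij_betw_byWitness[where f' = "\<lambda>y. y / t"]) auto
  then have "(\<Prod>y\<in>UNIV - {0}. t * y) = \<Prod>(UNIV - {0})"
    by (simp add: prod.reindex_bij_betw[where g = "\<lambda>y. y"])
  then have "t ^ (CARD('k) - 1) = 1"
    by (simp add: prod.distrib)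
  then show ?thesis
    using power_minus_mult[of "CARD('k)" t] by simp
qed simp

text \<open>
  Translation by \<open>1\<close> permutes the field, so it does not change the sum of all elements; yet it adds
  \<open>1\<close> to each of them.
\<close>

lemma finite_field_of_nat_card:
  "of_nat CARD('k) = (0 :: 'k::{field,finite})"
proof -
  have "(\<Sum>t\<in>UNIV. t + 1) = \<Sum>(UNIV :: 'k set)"
    using sum.reindex_bij_betw[OF bij_plus_right, of "\<lambda>t. t" "1 :: 'k"] by simp
  then show ?thesis
    by (simp add: sum.distrib)
qed

lemma finite_field_card_ge_2: "2 \<le> CARD('k::{field,finite})"
proof -
  have "card {0, 1 :: 'k} \<le> CARD('k)"
    by (rule card_mono) auto
  then show ?thesis
    by simp
qed

section \<open>Vector-valued polynomials and subspaces\<close>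

context vector_space
begin

text \<open>
  A polynomial with vector coefficients and more roots than its degree is zero: in each coordinate
  with respect to a basis it is an ordinary polynomial.
\<close>

lemma vector_polynomial_coeff_eq_0:
  fixes v :: "nat \<Rightarrow> 'b"
  assumes card: "m \<le> card T"
    and root: "\<And>t. t \<in> T \<Longrightarrow> (\<Sum>j<m. t ^ j *s v j) = 0"
    and "i < m"
  shows "v i = 0"
proof -
  define B where "B = extend_basis {}"
  have indep: "independent B" and span: "span B = UNIV"
    unfolding B_def by (simp_all add: independent_extend_basis independent_empty)
  have "representation B (v i) b = 0" for b
  proof -
    define p where "p = (\<Sum>j<m. monom (representation B (v j) b) j)"
    have "poly p t = 0" if "t \<in> T" for t
    proof -
      have "representation B (\<Sum>j<m. t ^ j *s v j) b = poly p t"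
        by (simp add: p_def poly_sum poly_monom representation_sum[OF indep] span
            representation_scale[OF indep] mult.commute)
      then show ?thesis
        using root[OF that] by (simp add: representation_zero)
    qed
    moreover have "degree p < card T"
    proof -
      have "degree p \<le> m - 1"
        unfolding p_def
        by (rule degree_sum_le) (auto intro: order.trans[OF degree_monom_le])
      then show ?thesis
        using card \<open>i < m\<close> by linarith
    qed
    ultimately have "p = 0"
      by (intro poly_eqI_degree[where A = T]) auto
    then have "coeff p i = 0"
      by simp
    then show ?thesis
      using \<open>i < m\<close> by (simp add: p_def coeff_sum)
  qed
  then show ?thesis
    using sum_nonzero_representation_eq[OF indep, of "v i"] span by simp
qed

text \<open>
  For \<open>y \<in> K - H\<close> the map \<open>(t, h) \<mapsto> h + t y\<close> from \<open>F \<times> H\<close> to \<open>K\<close> is injective, and it is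
  onto exactly when \<open>H\<close> is a hyperplane of \<open>K\<close>. Counting thus stands in for dimensions.
\<close>

lemma card_hyperplane:
  fixes H K :: "'b set"
  assumes "subspace H" "subspace K" "H \<subseteq> K" "finite K" "y \<in> K" "y \<notin> H"
  shows card_proper_subspace_le: "CARD('a) * card H \<le> card K"
    and card_hyperplane_iff:
      "CARD('a) * card H = card K \<longleftrightarrow> (\<forall>z\<in>K. \<exists>t. z - t *s y \<in> H)"
proof -
  let ?f = "\<lambda>(t, h). h + t *s y"
  have inj: "inj_on ?f (UNIV \<times> H)"
  proof (rule inj_onI, clarify)
    fix t u g h
    assume mem: "g \<in> H" "h \<in> H" and eq: "g + t *s y = h + u *s y"
    have "(t - u) *s y = h - g"
      using eq by (simp add: scale_left_diff_distrib algebra_simps)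
    then have "(t - u) *s y \<in> H"
      using mem \<open>subspace H\<close> by (simp add: subspace_diff)
    then have "inverse (t - u) *s (t - u) *s y \<in> H"
      using \<open>subspace H\<close> by (rule subspace_scale[rotated])
    then have "t = u"
      using \<open>y \<notin> H\<close> by (cases "t = u") auto
    then show "t = u \<and> g = h"
      using eq by simp
  qed
  have sub: "?f ` (UNIV \<times> H) \<subseteq> K"
    using assms by (auto intro!: subspace_add subspace_scale)
  have card: "card (?f ` (UNIV \<times> H)) = CARD('a) * card H"
    using inj by (simp add: card_image card_cartesian_product)
  show "CARD('a) * card H \<le> card K"
    using card_mono[OF \<open>finite K\<close> sub] card by simp
  have "CARD('a) * card H = card K \<longleftrightarrow> ?f ` (UNIV \<times> H) = K"
    using card card_subset_eq[OF \<open>finite K\<close> sub] by metis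
  also have "\<dots> \<longleftrightarrow> (\<forall>z\<in>K. \<exists>t. z - t *s y \<in> H)"
  proof
    assume K: "?f ` (UNIV \<times> H) = K"
    show "\<forall>z\<in>K. \<exists>t. z - t *s y \<in> H"
    proof
      fix z assume "z \<in> K"
      then obtain u h where "h \<in> H" and z: "z = h + u *s y"
        unfolding K[symmetric] by auto
      then have "z - u *s y \<in> H"
        by simp
      then show "\<exists>t. z - t *s y \<in> H" ..
    qed
  next
    assume *: "\<forall>z\<in>K. \<exists>t. z - t *s y \<in> H"
    have "z \<in> ?f ` (UNIV \<times> H)" if z: "z \<in> K" for z
    proof -
      obtain t where "z - t *s y \<in> H"
        using * z by blast
      then show ?thesis
        by (intro rev_image_eqI[of "(t, z - t *s y)"]) simp_all
    qed
    then show "?f ` (UNIV \<times> H) = K"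
      by (intro equalityI[OF sub] subsetI)
  qed
  finally show "CARD('a) * card H = card K \<longleftrightarrow> (\<forall>z\<in>K. \<exists>t. z - t *s y \<in> H)" .
qed

end

section \<open>Expanding a power along an affine line\<close>

text \<open>
  \<open>line_coeff y x m i\<close> is the coefficient of \<open>t\<^sup>i\<close> in \<open>(y + t x)\<^sup>m\<close> for a central \<open>t\<close>, that is, the sum
  of all words in \<open>x\<close> and \<open>y\<close> of length \<open>m\<close> with exactly \<open>i\<close> letters \<open>x\<close>. The recursion splits off the first letter.
\<close>

primrec line_coeff :: "'a::ring_1 \<Rightarrow> 'a \<Rightarrow> nat \<Rightarrow> nat \<Rightarrow> 'a" where
  "line_coeff y x 0 = (\<lambda>i. if i = 0 then 1 else 0)"
| "line_coeff y x (Suc m) =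
    (\<lambda>i. y * line_coeff y x m i + (case i of 0 \<Rightarrow> 0 | Suc j \<Rightarrow> x * line_coeff y x m j))"

lemma line_coeff_beyond: "m < i \<Longrightarrow> line_coeff y x m i = 0"
  by (induction m arbitrary: i) (auto split: nat.split)

lemma line_coeff_0: "line_coeff y x m 0 = y ^ m"
  by (induction m) auto

lemma line_coeff_top: "line_coeff y x m m = x ^ m"
  by (induction m) (auto simp: line_coeff_beyond)

text \<open>
  The linear coefficient is the sum of the words \<open>y\<^sup>j x y\<^sup>k\<close> with \<open>j + k = m - 1\<close>, so multiplying it by
  \<open>y\<close> on the left and on the right gives two sums that differ only in their end terms.
\<close>

lemma line_coeff_1_commutator:
  "y * line_coeff y x m 1 - line_coeff y x m 1 * y = y ^ m * x - x * y ^ m"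
proof (induction m)
  case (Suc m)
  let ?L = "line_coeff y x m 1"
  have "y * line_coeff y x (Suc m) 1 - line_coeff y x (Suc m) 1 * y
      = y * (y * ?L - ?L * y) + y * x * y ^ m - x * y ^ m * y"
    by (simp add: line_coeff_0 algebra_simps)
  also have "\<dots> = y ^ Suc m * x - x * y ^ Suc m"
    unfolding Suc.IH by (simp add: algebra_simps power_commutes)
  finally show ?case .
qed simp

lemma central_power_diff_commutator:
  assumes "x \<in> central_power_diff q"
  shows "x ^ q * z - z * x ^ q = x * z - z * x"
  using assms by (simp add: central_power_diff_def ring_center_def algebra_simps)

text \<open>
  The commutator with \<open>e\<close> is a derivation. When \<open>d\<close> commutes with its derivative \<open>[d, e]\<close>, the usual
  power rule holds.
\<close>

lemma power_commutator_of_nested_commute: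
  fixes d e :: "'a::ring_1"
  assumes "d * (d * e - e * d) = (d * e - e * d) * d"
  shows "d ^ m * e - e * d ^ m = of_nat m * (d ^ (m - 1) * (d * e - e * d))"
proof (induction m)
  case (Suc m)
  define u where "u = d * e - e * d"
  have pow: "u * d ^ k = d ^ k * u" for k
    using assms by (simp add: u_def power_commuting_commutes)
  have "d ^ Suc m * e - e * d ^ Suc m = d * (d ^ m * e - e * d ^ m) + u * d ^ m"
    by (simp add: u_def algebra_simps)
  also have "\<dots> = of_nat m * (d * d ^ (m - 1) * u) + d ^ m * u"
    unfolding Suc.IH pow u_def[symmetric] by (simp add: mult.assoc mult_of_nat_commute)
  also have "of_nat m * (d * d ^ (m - 1) * u) = of_nat m * (d ^ m * u)"
    by (cases m) auto
  finally show ?case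
    by (simp add: u_def algebra_simps)
qed simp

section \<open>Counting along lines\<close>

locale finite_unital_algebra = unital_algebra scale
  for scale :: "'k::{field,finite} \<Rightarrow> 'a::{ring_1,finite} \<Rightarrow> 'a" (infixr "*s" 75)
begin

lemma power_line:
  "(y + t *s x) ^ m = (\<Sum>i\<le>m. t ^ i *s line_coeff y x m i)"
proof (induction m)
  case (Suc m)
  let ?L = "line_coeff y x m"
  have "(y + t *s x) ^ Suc m
      = (\<Sum>i\<le>m. t ^ i *s (y * ?L i)) + (\<Sum>i\<le>m. t ^ Suc i *s (x * ?L i))"
    by (simp add: Suc.IH distrib_right sum_distrib_left scale_mult_left scale_mult_right
        scale_sum_right scale_right_distrib sum.distrib mult.commute)
  also have "(\<Sum>i\<le>m. t ^ i *s (y * ?L i)) = (\<Sum>i\<le>Suc m. t ^ i *s (y * ?L i))"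
    by (simp add: line_coeff_beyond)
  also have "(\<Sum>i\<le>m. t ^ Suc i *s (x * ?L i))
      = (\<Sum>i\<le>Suc m. t ^ i *s (case i of 0 \<Rightarrow> 0 | Suc j \<Rightarrow> x * ?L j))"
    by (subst sum.atMost_Suc_shift) simp
  finally show ?case
    by (simp only: line_coeff.simps scale_right_distrib sum.distrib)
qed simp

text \<open>
  Taking commutators with \<open>z\<close> turns membership of the line in \<open>I\<close> into the vanishing of a polynomial
  in \<open>t\<close>. Its extreme coefficients drop out: the constant one because \<open>y \<in> I\<close>, and the one of \<open>t\<^sup>q = t\<close>,
  namely \<open>[x\<^sup>q, z]\<close>, because it cancels against the term \<open>t [x, z]\<close>. What is left says that the
  linear coefficient is central.
\<close>

lemma commute_of_line_subset_central_power_diff: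
  fixes x y :: 'a
  assumes x: "x \<in> central_power_diff CARD('k)"
    and line: "\<And>t. y + t *s x \<in> central_power_diff CARD('k)"
  shows "x * y = y * x"
proof -
  let ?q = "CARD('k)"
  let ?L = "line_coeff y x ?q"
  have q: "2 \<le> ?q"
    by (rule finite_field_card_ge_2)
  have y: "y \<in> central_power_diff ?q"
    using line[of 0] by simp
  have central: "?L 1 * z - z * ?L 1 = 0" for z
  proof -
    define g where "g i = ?L i * z - z * ?L i" for i
    \<comment> \<open>the coefficients that survive the cancellation of the terms of degree \<open>0\<close> and \<open>q\<close>\<close>
    define v where "v i = (if i = 0 then 0 else g i)" for i
    have "(\<Sum>i<?q. t ^ i *s v i) = 0" for t
    proof -
      have "(y + t *s x) ^ ?q * z - z * (y + t *s x) ^ ?q = (\<Sum>i\<le>?q. t ^ i *s g i)"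
        by (simp add: power_line g_def sum_distrib_left sum_distrib_right scale_mult_left
            scale_mult_right scale_right_diff_distrib sum_subtractf)
      also have "\<dots> = (\<Sum>i<?q. t ^ i *s g i) + t *s g ?q"
        by (simp add: finite_field_power_card flip: lessThan_Suc_atMost)
      also have "g ?q = x * z - z * x"
        using central_power_diff_commutator[OF x] by (simp add: g_def line_coeff_top)
      also have "(\<Sum>i<?q. t ^ i *s g i) = g 0 + (\<Sum>i<?q. t ^ i *s v i)"
        using q by (subst (1 2) sum.remove[of _ 0]) (auto simp: v_def intro: sum.cong)
      also have "g 0 = y * z - z * y"
        using central_power_diff_commutator[OF y] by (simp add: g_def line_coeff_0)
      finally show ?thesis
        using central_power_diff_commutator[OF line[of t], of z]
        by (simp add: algebra_simps scale_mult_left scale_mult_right)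
    qed
    then have "v 1 = 0"
      by (rule vector_polynomial_coeff_eq_0[where T = UNIV and m = ?q, OF order_refl]) (use q in simp)
    then show ?thesis
      by (simp add: v_def g_def)
  qed
  have "y * x - x * y = y ^ ?q * x - x * y ^ ?q"
    using central_power_diff_commutator[OF y] by simp
  also have "\<dots> = y * ?L 1 - ?L 1 * y"
    by (rule line_coeff_1_commutator[symmetric])
  also have "\<dots> = 0"
    using central[of y] by simp
  finally show ?thesis
    by simp
qed

lemma subspace_centralizer: "subspace (centralizer x)"
  by (simp add: subspace_def centralizer_def distrib_left distrib_right scale_mult_left
      scale_mult_right)

lemma card_centralizer_le:
  fixes x :: 'a
  assumes "x \<notin> ring_center"
  shows "CARD('k) * card (centralizer x) \<le> CARD('a)"
proof -
  obtain y where "y \<notin> centralizer x"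
    using assms unfolding ring_center_def centralizer_def by force
  from card_proper_subspace_le[OF subspace_centralizer subspace_UNIV _ _ _ this]
  show ?thesis
    by simp
qed

text \<open>
  Each \<open>y\<close> outside \<open>C\<^sub>x\<close> can be moved out of \<open>I\<close> by adding some \<open>t x\<close>, and this never leads into \<open>C\<^sub>x\<close>.
  So \<open>y\<close> is recovered from the new point and one of the \<open>q\<close> values of \<open>t\<close>.
\<close>

lemma card_outside_centralizer_le:
  fixes x :: 'a
  assumes x: "x \<in> central_power_diff CARD('k)"
  shows "card (- centralizer x)
    \<le> CARD('k) * card (- (centralizer x \<union> central_power_diff CARD('k)))"
proof -
  let ?I = "central_power_diff CARD('k) :: 'a set"
  let ?N = "- (centralizer x \<union> ?I)"
  have "- centralizer x \<subseteq> (\<lambda>(t, z). z - t *s x) ` (UNIV \<times> ?N)"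
  proof
    fix y assume y: "y \<in> - centralizer x"
    then obtain t where "y + t *s x \<notin> ?I"
      using commute_of_line_subset_central_power_diff[OF x, of y]
      by (auto simp: centralizer_def)
    moreover have "y + t *s x \<notin> centralizer x"
      using y by (simp add: centralizer_def algebra_simps scale_mult_left scale_mult_right)
    ultimately show "y \<in> (\<lambda>(t, z). z - t *s x) ` (UNIV \<times> ?N)"
      by (intro image_eqI[where x = "(t, y + t *s x)"]) auto
  qed
  then have "card (- centralizer x) \<le> card ((UNIV :: 'k set) \<times> ?N)"
    by (intro surj_card_le) auto
  then show ?thesis
    by (simp add: card_cartesian_product)
qed

lemma card_central_power_diff_le_centralizer:
  fixes x :: 'a
  assumes x: "x \<in> central_power_diff CARD('k)"
  shows "CARD('k) * card (central_power_diff CARD('k) \<union> centralizer x) + CARD('a)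
    \<le> CARD('k) * CARD('a) + card (centralizer x)"
proof -
  let ?U = "central_power_diff CARD('k) \<union> centralizer x"
  have compl: "card (- A) + card A = CARD('a)" for A :: "'a set"
    using card_Un_disjoint[of "- A" A] by (simp add: Compl_partition2)
  have "CARD('k) * card (- ?U) + CARD('k) * card ?U = CARD('k) * CARD('a)"
    using compl[of ?U] by (metis distrib_left)
  then show ?thesis
    using card_outside_centralizer_le[OF x] compl[of "centralizer x"]
    by (simp add: Un_commute)
qed

lemma ring_center_subset_centralizer: "ring_center \<subseteq> centralizer (x :: 'a)"
  by (auto simp: ring_center_def centralizer_def)

text \<open>
  Multiplying the previous estimate by \<open>q\<close> and bounding \<open>q |C\<^sub>x|\<close> by \<open>|R|\<close> yields the upper bound.
  In the extremal case both \<open>q |C\<^sub>x| \<le> |R|\<close> and \<open>|I| \<le> |I \<union> C\<^sub>x|\<close> must be equalities.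
\<close>

lemma card_central_power_diff_noncentral:
  fixes x :: 'a
  assumes x: "x \<in> central_power_diff CARD('k)" "x \<notin> ring_center"
  defines "q \<equiv> real CARD('k)"
  defines "N \<equiv> real CARD('a)"
  shows "q ^ 2 * card (central_power_diff CARD('k) :: 'a set) \<le> (q ^ 2 - q + 1) * N"
    and "q ^ 2 * card (central_power_diff CARD('k) :: 'a set) = (q ^ 2 - q + 1) * N \<Longrightarrow>
      CARD('k) * card (centralizer x) = CARD('a) \<and> centralizer x \<subseteq> central_power_diff CARD('k)"
proof -
  let ?I = "central_power_diff CARD('k) :: 'a set"
  let ?U = "?I \<union> centralizer x"
  have q: "q > 0"
    by (simp add: q_def)
  have "CARD('k) * card (centralizer x) \<le> CARD('a)"
    using x(2) by (rule card_centralizer_le)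
  then have A: "q * card (centralizer x) \<le> N"
    unfolding q_def N_def of_nat_mult[symmetric] of_nat_le_iff .
  have "q * card ?U + N \<le> q * N + card (centralizer x)"
    using card_central_power_diff_le_centralizer[OF x(1)]
    unfolding q_def N_def of_nat_mult[symmetric] of_nat_add[symmetric] of_nat_le_iff .
  from mult_left_mono[OF this, of q]
  have B: "q ^ 2 * card ?U + q * N \<le> q ^ 2 * N + q * card (centralizer x)"
    using q by (simp add: algebra_simps power2_eq_square)
  have IU: "card ?I \<le> card ?U"
    by (rule card_mono) auto
  then have E: "q ^ 2 * card ?I \<le> q ^ 2 * card ?U"
    by (intro mult_left_mono) auto
  show "q ^ 2 * card ?I \<le> (q ^ 2 - q + 1) * N"
    using A B E by (simp add: algebra_simps)
  assume eq: "q ^ 2 * card ?I = (q ^ 2 - q + 1) * N"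
  then have eq': "q ^ 2 * card ?I = q ^ 2 * N - q * N + N"
    by (simp add: algebra_simps)
  have "q * card (centralizer x) = N"
    using A B E eq' by linarith
  then have "CARD('k) * card (centralizer x) = CARD('a)"
    unfolding q_def N_def of_nat_mult[symmetric] of_nat_eq_iff .
  moreover have "q ^ 2 * card ?I = q ^ 2 * card ?U"
    using A B E eq' by linarith
  then have "card ?I = card ?U"
    using q by simp
  then have "?I = ?U"
    by (intro card_subset_eq) auto
  ultimately show "CARD('k) * card (centralizer x) = CARD('a) \<and> centralizer x \<subseteq> ?I"
    by blast
qed

text \<open>
  If \<open>I\<close> lies in a proper centralizer, then its density is at most \<open>1/q\<close>, which is less than
  \<open>(q\<^sup>2 - q + 1)/q\<^sup>2\<close> because the difference is \<open>((q - 1)/q)\<^sup>2\<close>. This settles the case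
  \<open>I \<subseteq> C\<close>, and in the extremal case it provides an element of \<open>I\<close> that does not commute with a
  given noncentral one.
\<close>

lemma card_central_power_diff_subset_centralizer:
  fixes x :: 'a
  assumes sub: "central_power_diff CARD('k) \<subseteq> centralizer x"
    and noncentral: "x \<notin> ring_center"
  defines "q \<equiv> real CARD('k)"
  shows "q ^ 2 * card (central_power_diff CARD('k) :: 'a set) < (q ^ 2 - q + 1) * real CARD('a)"
proof -
  let ?I = "central_power_diff CARD('k) :: 'a set"
  have "CARD('k) * card (centralizer x) \<le> CARD('a)"
    using noncentral by (rule card_centralizer_le)
  moreover have "card ?I \<le> card (centralizer x)"
    using sub by (intro card_mono) auto
  ultimately have "CARD('k) * card ?I \<le> CARD('a)"
    by (meson mult_le_mono2 order.trans)
  then have "q * card ?I \<le> real CARD('a)"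
    unfolding q_def of_nat_mult[symmetric] of_nat_le_iff .
  then have "q * (q * card ?I) \<le> q * real CARD('a)"
    by (rule mult_left_mono) (simp add: q_def)
  also have "\<dots> < (q ^ 2 - q + 1) * real CARD('a)"
  proof (rule mult_strict_right_mono)
    have "q \<ge> 2"
      using finite_field_card_ge_2[where 'k = 'k] by (simp add: q_def)
    then have "(q - 1) ^ 2 > 0"
      by simp
    then show "q < q ^ 2 - q + 1"
      by (simp add: power2_eq_square algebra_simps)
  qed simp
  finally show ?thesis
    by (simp add: power2_eq_square mult.assoc)
qed

section \<open>The extremal case\<close>

text \<open>
  By the power rule \<open>[d\<^sup>q, e] = q d\<^sup>q\<^sup>-\<^sup>1 [d, e]\<close>, which is zero since the characteristic divides \<open>q\<close>;
  on the other hand \<open>[d\<^sup>q, e] = [d, e]\<close>.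
\<close>

lemma commute_of_nested_commute:
  fixes d e :: 'a
  assumes d: "d \<in> central_power_diff CARD('k)"
    and nested: "d * (d * e - e * d) = (d * e - e * d) * d"
  shows "d * e = e * d"
proof -
  have scale: "of_nat m *s 1 = (of_nat m :: 'a)" for m
    by (induction m) (simp_all add: scale_left_distrib)
  have "of_nat CARD('k) = (0 :: 'a)"
    using scale[of "CARD('k)"] by (simp add: finite_field_of_nat_card)
  then show ?thesis
    using power_commutator_of_nested_commute[OF nested, of "CARD('k)"]
      central_power_diff_commutator[OF d, of e] by simp
qed

text \<open>
  The hypothesis is the information that equality gives about every noncentral element of \<open>I\<close>. Using it
  for \<open>b\<close> and \<open>c\<close> yields the decomposition of \<open>R\<close>; using it for the further elements \<open>d + b\<close> with
  \<open>d \<in> C\<^sub>b \<inter> C\<^sub>c\<close> makes \<open>C\<^sub>b \<inter> C\<^sub>c\<close> commutative, hence central.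
\<close>

lemma extremal_structure:
  fixes b c z :: 'a
  assumes extremal: "\<And>x :: 'a. x \<in> central_power_diff CARD('k) \<Longrightarrow> x \<notin> ring_center \<Longrightarrow>
      CARD('k) * card (centralizer x) = CARD('a) \<and> centralizer x \<subseteq> central_power_diff CARD('k)"
    and b: "b \<in> central_power_diff CARD('k)" and c: "c \<in> central_power_diff CARD('k)"
    and bc: "b * c \<noteq> c * b"
  shows "ring_center = centralizer b \<inter> centralizer c"
    and "\<exists>s t. z - s *s b - t *s c \<in> ring_center"
    and "CARD('k) * card (ring_center :: 'a set) = card (centralizer b)"
proof -
  let ?I = "central_power_diff CARD('k) :: 'a set"
  let ?D = "centralizer b \<inter> centralizer c"
  have noncentral: "b \<notin> ring_center" "c \<notin> ring_center"
    using bc unfolding ring_center_def by force+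
  have self: "x \<in> centralizer x" for x :: 'a
    by (simp add: centralizer_def)
  have c_nb: "c \<notin> centralizer b" and b_nc: "b \<notin> centralizer c"
    using bc by (auto simp: centralizer_def)
  have line: "\<exists>t. z - t *s y \<in> centralizer x"
    if "x \<in> ?I" "x \<notin> ring_center" "y \<notin> centralizer x" for x y z
    using card_hyperplane_iff[OF subspace_centralizer[of x] subspace_UNIV, of y]
      extremal[OF that(1,2)] that(3) by auto
  have dec: "\<exists>s t. z - s *s b - t *s c \<in> ?D" for z
  proof -
    obtain s where s: "z - s *s b \<in> centralizer c"
      using line[OF c noncentral(2) b_nc] by blast
    obtain t where t: "(z - s *s b) - t *s c \<in> centralizer b"
      using line[OF b noncentral(1) c_nb] by blast
    have "(z - s *s b) - t *s c \<in> centralizer c"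
      by (rule subspace_diff[OF subspace_centralizer s subspace_scale[OF subspace_centralizer self]])
    with t show ?thesis
      by blast
  qed
  have comm: "d * e = e * d" if d: "d \<in> ?D" and e: "e \<in> ?D" for d e
  proof (rule commute_of_nested_commute)
    show "d \<in> ?I"
      using extremal[OF b noncentral(1)] d by blast
    have "d + b \<in> centralizer b"
      using d self[of b] subspace_centralizer by (intro subspace_add) auto
    then have dbI: "d + b \<in> ?I"
      using extremal[OF b noncentral(1)] by blast
    have c_ndb: "c \<notin> centralizer (d + b)"
      using d bc by (auto simp: centralizer_def algebra_simps)
    then have "d + b \<notin> ring_center"
      using ring_center_subset_centralizer[of c] by (auto simp: centralizer_def)
    \<comment> \<open>the centralizer of \<open>d + b\<close> is a hyperplane without \<open>c\<close>, so it meets the line through \<open>e\<close>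
      in direction \<open>c\<close>\<close>
    from line[OF dbI this c_ndb] obtain t where "e - t *s c \<in> centralizer (d + b)"
      by blast
    then have proportional: "d * e - e * d = t *s (b * c - c * b)"
      using d e
      by (simp add: centralizer_def algebra_simps scale_mult_left scale_mult_right)
    have "d * (b * c) = (b * c) * d" "d * (c * b) = (c * b) * d"
      using d by (simp_all add: centralizer_def) (metis mult.assoc)+
    then show "d * (d * e - e * d) = (d * e - e * d) * d"
      unfolding proportional by (simp add: scale_mult_left scale_mult_right algebra_simps)
  qed
  show center: "ring_center = ?D"
  proof
    show "ring_center \<subseteq> ?D"
      using ring_center_subset_centralizer by blast
    show "?D \<subseteq> ring_center"
    proof
      fix d assume d: "d \<in> ?D"
      have "z \<in> centralizer d" for z
      proof -
        obtain s t where "z - s *s b - t *s c \<in> ?D"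
          using dec by blast
        from comm[OF this d] have "z - s *s b - t *s c \<in> centralizer d"
          by (simp only: centralizer_def mem_Collect_eq)
        moreover have "b \<in> centralizer d" "c \<in> centralizer d"
          using d by (simp_all add: centralizer_def)
        ultimately have "(z - s *s b - t *s c) + t *s c + s *s b \<in> centralizer d"
          using subspace_centralizer by (intro subspace_add subspace_scale) auto
        then show ?thesis
          by simp
      qed
      then show "d \<in> ring_center"
        by (auto simp: ring_center_def centralizer_def)
    qed
  qed
  show "\<exists>s t. z - s *s b - t *s c \<in> ring_center"
    unfolding center by (rule dec)
  have "\<exists>s. z - s *s b \<in> ?D" if z: "z \<in> centralizer b" for z
  proof -
    obtain s where "z - s *s b \<in> centralizer c"
      using line[OF c noncentral(2) b_nc] by blast
    moreover have "z - s *s b \<in> centralizer b"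
      using z self[of b] subspace_centralizer by (intro subspace_diff subspace_scale) auto
    ultimately show ?thesis
      by blast
  qed
  then show "CARD('k) * card (ring_center :: 'a set) = card (centralizer b)"
    using card_hyperplane_iff[of ?D "centralizer b" b] self[of b] b_nc
    by (simp add: center subspace_inter subspace_centralizer)
qed

lemma generated_subalgebra_eq_UNIV:
  assumes "\<And>z. \<exists>s t. z - s *s b - t *s c \<in> Z"
  shows "generated_subalgebra (Z \<union> {b, c}) = UNIV"
proof -
  have "z \<in> S" if "subalgebra S" "Z \<union> {b, c} \<subseteq> S" for S z
  proof -
    obtain s t where "z - s *s b - t *s c \<in> Z"
      using assms by blast
    then have "(z - s *s b - t *s c) + t *s c + s *s b \<in> S"
      using that unfolding subalgebra_def by (intro subspace_add subspace_scale) auto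
    then show ?thesis
      by simp
  qed
  then show ?thesis
    by (auto simp: generated_subalgebra_def hull_def)
qed

lemma ring_center_subset_central_power_diff:
  "(ring_center :: 'a set) \<subseteq> central_power_diff m"
proof
  fix z :: 'a
  assume "z \<in> ring_center"
  then have "z * x = x * z" for x
    by (simp add: ring_center_def)
  moreover from this have "z ^ m * x = x * z ^ m" for x
    by (metis power_commuting_commutes)
  ultimately show "z \<in> central_power_diff m"
    by (simp add: central_power_diff_def ring_center_def algebra_simps)
qed

end

theorem theorem1p5:
  fixes scale :: "'k::{field,finite} \<Rightarrow> 'a::{ring_1,finite} \<Rightarrow> 'a"
    and q n :: nat
    and C I :: "'a set"
    and r :: real
  assumes alg: "unital_algebra scale"
    and card_field: "CARD('k) = q"
    and card_algebra: "CARD('a) = q ^ n"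
    and noncommutative: "\<exists>x y :: 'a. x * y \<noteq> y * x"
  defines "C \<equiv> ring_center"
    and "I \<equiv> central_power_diff q"
    and "r \<equiv> real (card I) / real (CARD('a))"
  shows "r \<le> (real q ^ 2 - real q + 1) / real q ^ 2 \<and>
    (r = (real q ^ 2 - real q + 1) / real q ^ 2 \<longrightarrow>
      (\<exists>b c. b \<in> I \<and> c \<in> I \<and> b * c \<noteq> c * b \<and>
        unital_algebra.generated_subalgebra scale (C \<union> {b, c}) = UNIV \<and>
        C \<subseteq> I \<and> card C = q ^ (n - 2) \<and>
        card (centralizer b) = q ^ (n - 1) \<and> card (centralizer c) = q ^ (n - 1)))"
proof -
  interpret finite_unital_algebra scale
    using alg by (simp add: finite_unital_algebra_def)
  have q: "q \<ge> 2"
    using finite_field_card_ge_2[where 'k = 'k] card_field by simp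
  have N: "real CARD('a) > 0"
    by simp
  have Iq: "I = central_power_diff CARD('k)"
    by (simp add: I_def card_field)
  let ?rhs = "(real q ^ 2 - real q + 1) * real CARD('a)"
  have r_le: "r \<le> (real q ^ 2 - real q + 1) / real q ^ 2 \<longleftrightarrow> real q ^ 2 * card I \<le> ?rhs"
    using q N unfolding r_def by (simp add: divide_simps mult.commute)
  have r_eq: "r = (real q ^ 2 - real q + 1) / real q ^ 2 \<longleftrightarrow> real q ^ 2 * card I = ?rhs"
    using q N unfolding r_def by (simp add: divide_simps mult.commute)
  have below: "real q ^ 2 * card I < ?rhs" if "I \<subseteq> centralizer x" "x \<notin> ring_center" for x
    using card_central_power_diff_subset_centralizer[of x] that
    unfolding Iq card_field[symmetric] by blast
  have below_central: "real q ^ 2 * card I < ?rhs" if "I \<subseteq> ring_center"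
  proof -
    obtain x :: 'a where "x \<notin> ring_center"
      using noncommutative by (auto simp: ring_center_def)
    then show ?thesis
      using that ring_center_subset_centralizer[of x] by (intro below[of x]) auto
  qed
  have bound: "real q ^ 2 * card I \<le> ?rhs"
  proof (cases "I \<subseteq> ring_center")
    case True
    then show ?thesis
      using below_central by simp
  next
    case False
    then show ?thesis
      using card_central_power_diff_noncentral(1)
      unfolding Iq card_field[symmetric] by blast
  qed
  have "\<exists>b c. b \<in> I \<and> c \<in> I \<and> b * c \<noteq> c * b \<and>
        generated_subalgebra (C \<union> {b, c}) = UNIV \<and>
        C \<subseteq> I \<and> card C = q ^ (n - 2) \<and>
        card (centralizer b) = q ^ (n - 1) \<and> card (centralizer c) = q ^ (n - 1)"
    if eq: "real q ^ 2 * card I = ?rhs"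
  proof -
    have "\<not> I \<subseteq> ring_center"
      using below_central eq by auto
    then obtain b where b: "b \<in> I" "b \<notin> ring_center"
      by blast
    have extremal: "CARD('k) * card (centralizer x) = CARD('a) \<and> centralizer x \<subseteq> I"
      if "x \<in> I" "x \<notin> ring_center" for x
      using card_central_power_diff_noncentral(2)[of x] eq that
      unfolding Iq card_field[symmetric] by blast
    have "\<not> I \<subseteq> centralizer b"
      using below[of b] b(2) eq by auto
    then obtain c where c: "c \<in> I" "c \<notin> centralizer b"
      by blast
    then have bc: "b * c \<noteq> c * b" and c': "c \<notin> ring_center"
      using ring_center_subset_centralizer[of b] by (auto simp: centralizer_def)
    have cards: "card (centralizer x) = q ^ (n - 1)" if "x \<in> I" "x \<notin> ring_center" for x
    proof -
      have "q * card (centralizer x) = q ^ n"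
        using extremal[OF that] card_field card_algebra by simp
      then show ?thesis
        using q by (cases n) auto
    qed
    note struct = extremal_structure[of b c, folded Iq, OF extremal b(1) c(1) bc]
    have "q * card C = q ^ (n - 1)"
      using struct(3) cards[OF b] card_field by (simp add: C_def)
    \<comment> \<open>if \<open>n - 1 = 0\<close>, then \<open>q |C| = 1\<close>, contrary to \<open>q \<ge> 2\<close>\<close>
    then have "card C = q ^ (n - 2)"
      using q by (cases "n - 1") (auto simp: numeral_2_eq_2)
    moreover have "generated_subalgebra (C \<union> {b, c}) = UNIV"
      using struct(2) by (intro generated_subalgebra_eq_UNIV) (simp add: C_def)
    moreover have "C \<subseteq> I"
      unfolding C_def I_def by (rule ring_center_subset_central_power_diff)
    ultimately show ?thesis
      using b c cards c' bc by blast
  qed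
  then show ?thesis
    using bound r_le r_eq by blast
qed

end
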